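(* Let $X\subset\mathbb{R}^2$ be a real algebraic curve, let $x\in X$ be an algebraic singular point with local branch parametrized, in Euclidean coordinates with $x$ at the origin and the $x_1$-axis along the tangent line, by $$x_1(t)=t^p,\qquad x_2(t)=c\,t^q+\sigma_{q+1}(t),\qquad q>p\ge2,\ c\neq0,$$ and let $\rho=\frac{q}{2p}$. Let $u=(0,u_2)\in N_x=\{u_1=0\}$. Then, for the local behaviour of $\mathbb{D}_u$ at $x$ (on the normalized branch): - If $\rho>1$ (i.e. $q>2p$), then $\mathbb{D}_u$ has a minimum at $x$ for all $u\in N_x$, and there is no focal point on $N_x$. - If $\rho=1$ (i.e. $q=2p$), then there is a focal point $u\ne x$ on $N_x$, where a minimum changes into a maximum. - If $\rho<1$ (i.e. $q<2p$) and $u_2\neq 0$, then $\mathbb{D}_u$ is topologically regular at $x$ if $q$ is odd, and has a maximum or a minimum at $x$ if $q$ is even; the point $u=x$ is the single focal point on $N_x$. If $u_1=u_2=0$, then $\mathbb{D}_u$ has a minimum at $x$.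
   Context: $X$ is a reduced real algebraic curve $\Phi=0$ all of whose local branches are real and $1$-dimensional; an algebraic singular point is a point of $X$ with $\nabla\Phi=0$. $\sigma_{q+1}$ is a real convergent power series with all terms of degree $>q$. $\mathbb{D}_u(y)=|y-u|^2$ for $y\in X$, considered as a function of the parameter $t$ on the branch. $\mathbb{D}_u$ is topologically regular at $x$ if it is locally homeomorphic to a linear function. $N_x$ is the line through $x$ orthogonal to the tangent line of the branch. A focal point on the normal line $N_x$ is a point $u\in N_x$ where the local type of $\mathbb{D}_u$ at $x$ (topologically regular, minimum, maximum, as $u$ varies in $N_x$) is different from the generic types on the normal line, i.e. a point of $N_x$ at which the local type is not that of a generic point or at which the local type changes (the center of the best-tangent circle). The number $\rho$ is called the competition factor. *)

theory Defs
  imports "HOL-Analysis.Analysis" "HOL-Computational_Algebra.Computational_Algebra"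
begin

text \<open>
  A polynomial in two variables is a \<open>real poly poly\<close>: the outer variable is the second
  coordinate, the inner variable is the first coordinate.
\<close>

definition eval2 :: "'a::comm_ring_1 poly poly \<Rightarrow> 'a \<Rightarrow> 'a \<Rightarrow> 'a" where
  "eval2 \<Phi> a b = poly (poly \<Phi> [:b:]) a"

definition plane_fun :: "real poly poly \<Rightarrow> real^2 \<Rightarrow> real" where
  "plane_fun \<Phi> y = eval2 \<Phi> (y $ 1) (y $ 2)"

definition curve :: "real poly poly \<Rightarrow> (real^2) set" where
  "curve \<Phi> = {y. plane_fun \<Phi> y = 0}"

definition algebraic_singular_point :: "real poly poly \<Rightarrow> real^2 \<Rightarrow> bool" where
  "algebraic_singular_point \<Phi> y \<longleftrightarrow> y \<in> curve \<Phi> \<and> GDERIV (plane_fun \<Phi>) y :> 0"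


text \<open>
  A local branch is represented by its normalization, that is, by a pair of convergent power
  series in one parameter which annihilates \<open>\<Phi>\<close> and does not factor through a substitution
  of order at least two.  The scalars are \<open>real\<close> or \<open>complex\<close>; the centre is a real point.
\<close>

definition primitive_arc :: "('k::field fps)^2 \<Rightarrow> bool" where
  "primitive_arc G \<longleftrightarrow>
     (\<forall>H \<tau>. fps_nth \<tau> 0 = 0 \<and> (\<forall>i. G $ i = fps_compose (H $ i) \<tau>) \<longrightarrow> fps_nth \<tau> 1 \<noteq> 0)"
  \<comment> \<open>A constant arc is not primitive: take \<open>\<tau> = 0\<close>.\<close>

definition local_branch ::
    "real poly poly \<Rightarrow> real^2 \<Rightarrow> ('k::{real_normed_field, banach} fps)^2 \<Rightarrow> bool" where
  "local_branch \<Phi> y G \<longleftrightarrow>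
     (\<forall>i. fps_conv_radius (G $ i) > 0) \<and>
     (\<forall>i. fps_nth (G $ i) 0 = of_real (y $ i)) \<and>
     eval2 (map_poly (map_poly (\<lambda>r. fps_const (of_real r))) \<Phi>) (G $ 1) (G $ 2) = 0 \<and>
     primitive_arc G"

text \<open>
  A complex branch is real if some reparametrization of it has real coefficients.  Its real
  points near the centre then contain the image of a nonconstant real arc, so that the branch
  is 1-dimensional over the reals as well.  (An isolated real point only carries pairs of
  complex conjugate branches, which are not real in this sense.)
\<close>

definition real_branch :: "(complex fps)^2 \<Rightarrow> bool" where
  "real_branch G \<longleftrightarrow>
     (\<exists>(R :: (real fps)^2) \<tau>. fps_nth \<tau> 0 = 0 \<and> fps_nth \<tau> 1 \<noteq> 0 \<and>
        (\<forall>i. G $ i = fps_compose (Abs_fps (\<lambda>n. complex_of_real (fps_nth (R $ i) n))) \<tau>))"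

definition reduced_real_curve :: "real poly poly \<Rightarrow> bool" where
  "reduced_real_curve \<Phi> \<longleftrightarrow>
     squarefree \<Phi> \<and> (\<forall>y\<in>curve \<Phi>. \<forall>G. local_branch \<Phi> y G \<longrightarrow> real_branch G)"

definition branch_map :: "(real fps)^2 \<Rightarrow> real \<Rightarrow> real^2" where
  "branch_map G t = (\<chi> i. eval_fps (G $ i) t)"


text \<open>
  In the following \<open>\<gamma>\<close> is a map defined near \<open>0\<close>, and \<open>\<gamma> 0\<close> is the centre of the branch.
\<close>

definition tangent_direction :: "(real \<Rightarrow> real^2) \<Rightarrow> real^2 \<Rightarrow> bool" where
  "tangent_direction \<gamma> v \<longleftrightarrow>
     ((\<lambda>t. (\<gamma> t - \<gamma> 0) /\<^sub>R norm (\<gamma> t - \<gamma> 0)) \<longlongrightarrow> v) (at_right 0) \<and> norm v = 1"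

definition tangent_line :: "(real \<Rightarrow> real^2) \<Rightarrow> (real^2) set" where
  "tangent_line \<gamma> = {\<gamma> 0 + s *\<^sub>R v |s v. tangent_direction \<gamma> v}"

definition normal_line :: "(real \<Rightarrow> real^2) \<Rightarrow> (real^2) set" where
  "normal_line \<gamma> = {u. \<forall>y\<in>tangent_line \<gamma>. orthogonal (u - \<gamma> 0) (y - \<gamma> 0)}"

definition sq_dist :: "(real \<Rightarrow> real^2) \<Rightarrow> real^2 \<Rightarrow> real \<Rightarrow> real" where
  "sq_dist \<gamma> u t = (norm (\<gamma> t - u))\<^sup>2"


text \<open>
  Minimum and maximum are strict, so that the three types exclude each other.  For a
  real-analytic nonconstant function of one variable this agrees with the non-strict notions.
\<close>

definition topologically_regular_at :: "(real \<Rightarrow> real) \<Rightarrow> real \<Rightarrow> bool" where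
  "topologically_regular_at f a \<longleftrightarrow>
     (\<exists>U V h k \<alpha> \<beta>. open U \<and> a \<in> U \<and> open V \<and> homeomorphism U V h k \<and>
        \<beta> \<noteq> 0 \<and> (\<forall>t\<in>U. f t = \<alpha> + \<beta> * h t))"

definition local_minimum_at :: "(real \<Rightarrow> real) \<Rightarrow> real \<Rightarrow> bool" where
  "local_minimum_at f a \<longleftrightarrow> (\<forall>\<^sub>F t in at a. f a < f t)"

definition local_maximum_at :: "(real \<Rightarrow> real) \<Rightarrow> real \<Rightarrow> bool" where
  "local_maximum_at f a \<longleftrightarrow> (\<forall>\<^sub>F t in at a. f t < f a)"

definition same_local_type :: "(real \<Rightarrow> real) \<Rightarrow> (real \<Rightarrow> real) \<Rightarrow> real \<Rightarrow> bool" where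
  "same_local_type f g a \<longleftrightarrow>
     (topologically_regular_at f a \<longleftrightarrow> topologically_regular_at g a) \<and>
     (local_minimum_at f a \<longleftrightarrow> local_minimum_at g a) \<and>
     (local_maximum_at f a \<longleftrightarrow> local_maximum_at g a)"

text \<open>
  The generic points of the normal line are those near which the local type is constant along
  the line.  A focal point is a non-generic point: either its own type differs from the type
  at the neighbouring points, or the type changes when passing through it.
\<close>

definition focal_point :: "(real \<Rightarrow> real^2) \<Rightarrow> real^2 \<Rightarrow> bool" where
  "focal_point \<gamma> u \<longleftrightarrow>
     u \<in> normal_line \<gamma> \<and>
     \<not> (\<forall>\<^sub>F v in at u within normal_line \<gamma>. same_local_type (sq_dist \<gamma> v) (sq_dist \<gamma> u) 0)"

text \<open>Here \<open>n\<close> is a vector along the normal line; the line is traversed in its direction.\<close>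

definition min_changes_into_max :: "(real \<Rightarrow> real^2) \<Rightarrow> real^2 \<Rightarrow> real^2 \<Rightarrow> bool" where
  "min_changes_into_max \<gamma> u n \<longleftrightarrow>
     (\<forall>\<^sub>F h in at_right 0. local_minimum_at (sq_dist \<gamma> (u - h *\<^sub>R n)) 0) \<and>
     (\<forall>\<^sub>F h in at_right 0. local_maximum_at (sq_dist \<gamma> (u + h *\<^sub>R n)) 0)"

definition competition_factor :: "nat \<Rightarrow> nat \<Rightarrow> real" where
  "competition_factor p q = real q / (2 * real p)"

end

theory Submission
  imports Defs
begin

text \<open>
  On the normal line, \<open>\<bar>\<gamma>(t) - x - w e\<^sub>2\<bar>\<^sup>2 = w\<^sup>2 + t\<^bsup>2p\<^esup> - 2 w c t\<^bsup>q\<^esup> + \<dots>\<close>, and the local type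
  of an analytic function is read off the parity and the sign of its first nonconstant term:
  \<open>t\<^bsup>2p\<^esup>\<close> competes with \<open>t\<^bsup>q\<^esup>\<close>, and \<open>\<rho>\<close> tells which of the two wins.
\<close>

section \<open>Local types of analytic functions\<close>

text \<open>The power \<open>t ^ m\<close> splits off, and the remaining factor is continuous with
  the nonzero value \<open>fps_nth F m\<close> at 0, so it keeps this sign nearby.\<close>

lemma eventually_sgn_of_expansion:
  fixes f :: "real \<Rightarrow> real"
  assumes f: "f has_fps_expansion F"
    and zero: "\<And>k. k < m \<Longrightarrow> fps_nth F k = 0"
    and lead: "fps_nth F m \<noteq> 0"
  shows "\<forall>\<^sub>F t in at 0. sgn (f t) = sgn (fps_nth F m) * sgn t ^ m"
proof -
  define H where "H = fps_shift m F"
  have F: "F = fps_X ^ m * H"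
    using zero by (auto simp: H_def fps_eq_iff fps_X_power_mult_nth)
  have rad: "fps_conv_radius H > 0"
    using f by (simp add: H_def has_fps_expansion_def)
  then have H: "eval_fps H has_fps_expansion H"
    by (rule eval_fps_has_fps_expansion)
  have "(\<lambda>t. t ^ m * eval_fps H t) has_fps_expansion F"
    unfolding F by (intro has_fps_expansion_mult has_fps_expansion_fps_X_power H)
  then have "\<forall>\<^sub>F t in nhds 0. f t = t ^ m * eval_fps H t"
    using f unfolding has_fps_expansion_def by (auto elim: eventually_elim2)
  then have eq: "\<forall>\<^sub>F t in at 0. f t = t ^ m * eval_fps H t"
    by (auto simp: eventually_at_filter elim: eventually_mono)
  have "isCont (eval_fps H) 0"
    using rad by (intro continuous_eval_fps) (simp add: zero_ereal_def)
  then have lim: "(eval_fps H \<longlongrightarrow> fps_nth F m) (at 0)"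
    by (simp add: isCont_def eval_fps_at_0 H_def)
  have "\<forall>\<^sub>F t in at 0. sgn (eval_fps H t) = sgn (fps_nth F m)"
  proof (cases "fps_nth F m > 0")
    case True
    with order_tendstoD(1)[OF lim True] show ?thesis
      by (auto elim: eventually_mono)
  next
    case False
    with lead have "fps_nth F m < 0" by simp
    with order_tendstoD(2)[OF lim this] show ?thesis
      by (auto elim: eventually_mono)
  qed
  with eq show ?thesis
    by eventually_elim (simp add: sgn_mult mult.commute)
qed

lemma has_fps_expansion_at_0:
  assumes "f has_fps_expansion F"
  shows "f 0 = fps_nth F 0"
proof -
  have "\<forall>\<^sub>F t in nhds 0. eval_fps F t = f t"
    using assms by (simp add: has_fps_expansion_def)
  from eventually_nhds_x_imp_x[OF this] show ?thesis
    by (simp add: eval_fps_at_0)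
qed

lemma eventually_sgn_diff_of_expansion:
  fixes f :: "real \<Rightarrow> real"
  assumes f: "f has_fps_expansion F" and "0 < m"
    and zero: "\<And>k. 0 < k \<Longrightarrow> k < m \<Longrightarrow> fps_nth F k = 0"
    and lead: "fps_nth F m \<noteq> 0"
  shows "\<forall>\<^sub>F t in at 0. sgn (f t - f 0) = sgn (fps_nth F m) * sgn t ^ m"
proof -
  \<comment> \<open>Removing the constant term makes all coefficients below \<open>m\<close> vanish
    and, as \<open>0 < m\<close>, leaves the one at \<open>m\<close> untouched.\<close>
  let ?F = "F - fps_const (fps_nth F 0)"
  have exp: "(\<lambda>t. f t - fps_nth F 0) has_fps_expansion ?F"
    by (intro has_fps_expansion_diff f has_fps_expansion_const)
  have below: "fps_nth ?F k = 0" if "k < m" for k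
    using zero[of k] that by (cases "k = 0") simp_all
  have at_m: "fps_nth ?F m = fps_nth F m"
    using \<open>0 < m\<close> by simp
  have "\<forall>\<^sub>F t in at 0. sgn (f t - fps_nth F 0) = sgn (fps_nth ?F m) * sgn t ^ m"
    by (rule eventually_sgn_of_expansion[OF exp below]) (simp_all add: \<open>0 < m\<close> lead)
  then show ?thesis
    by (simp only: at_m has_fps_expansion_at_0[OF f])
qed

lemma local_minimum_of_expansion:
  assumes "f has_fps_expansion F" "0 < m" "even m" "fps_nth F m > 0"
    and "\<And>k. 0 < k \<Longrightarrow> k < m \<Longrightarrow> fps_nth F k = 0"
  shows "local_minimum_at f 0"
proof -
  have "\<forall>\<^sub>F t in at 0. sgn (f t - f 0) = sgn (fps_nth F m) * sgn t ^ m"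
    using assms by (intro eventually_sgn_diff_of_expansion) auto
  then show ?thesis
    unfolding local_minimum_at_def using eventually_neq_at_within[of 0 0 UNIV]
  proof eventually_elim
    case (elim t)
    then have "sgn t ^ m = 1"
      using \<open>even m\<close> by (cases "t > 0") auto
    with elim(1) \<open>fps_nth F m > 0\<close> have "sgn (f t - f 0) = 1"
      by simp
    then show ?case
      by (simp add: sgn_1_pos)
  qed
qed

lemma local_maximum_iff_minimum_uminus:
  "local_maximum_at f a \<longleftrightarrow> local_minimum_at (\<lambda>t. - f t) a"
  by (simp add: local_maximum_at_def local_minimum_at_def)

lemma local_maximum_of_expansion:
  assumes "f has_fps_expansion F" "0 < m" "even m" "fps_nth F m < 0"
    and "\<And>k. 0 < k \<Longrightarrow> k < m \<Longrightarrow> fps_nth F k = 0"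
  shows "local_maximum_at f 0"
  unfolding local_maximum_iff_minimum_uminus
  by (rule local_minimum_of_expansion[OF has_fps_expansion_minus[OF assms(1)], of m])
     (use assms in auto)

text \<open>For \<open>m \<ge> 3\<close> the derivative vanishes at 0, so the inverse function
  theorem does not apply. Instead, injectivity on a small interval is combined with invariance of
  domain; then \<open>f\<close> is itself the required homeomorphism, with
  \<open>\<alpha> = 0\<close> and \<open>\<beta> = 1\<close>.\<close>

lemma topologically_regular_of_expansion:
  assumes f: "f has_fps_expansion F" and "odd m" and lead: "fps_nth F m \<noteq> 0"
    and zero: "\<And>k. 0 < k \<Longrightarrow> k < m \<Longrightarrow> fps_nth F k = 0"
  shows "topologically_regular_at f 0"
proof -
  have m: "0 < m" using \<open>odd m\<close> by (rule odd_pos)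
  have rad: "fps_conv_radius F > 0"
    using f by (simp add: has_fps_expansion_def)
  then have rad': "fps_conv_radius (fps_deriv F) > 0"
    using fps_conv_radius_deriv less_le_trans by blast
  \<comment> \<open>The derived series has its first nonzero coefficient at \<open>m - 1\<close>,
    namely \<open>m\<close> times that of \<open>F\<close> at \<open>m\<close>. Hence 0 is an
    isolated zero of the derivative, if it is a zero at all.\<close>
  have "\<forall>\<^sub>F t in at 0. sgn (eval_fps (fps_deriv F) t)
          = sgn (fps_nth (fps_deriv F) (m - 1)) * sgn t ^ (m - 1)"
    using m zero lead
    by (intro eventually_sgn_of_expansion eval_fps_has_fps_expansion rad') auto
  then have deriv: "\<forall>\<^sub>F t in at 0. eval_fps (fps_deriv F) t \<noteq> 0"
    using eventually_neq_at_within[of 0 0 UNIV]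
    by eventually_elim (use m lead in \<open>auto simp: sgn_if split: if_splits\<close>)
  \<comment> \<open>Since \<open>m\<close> is odd, \<open>sgn t ^ m = sgn t\<close>: the function
    crosses the level \<open>f 0\<close> at 0.\<close>
  have sgn: "\<forall>\<^sub>F t in at 0. sgn (f t - f 0) = sgn (fps_nth F m) * sgn t"
  proof -
    have "\<forall>\<^sub>F t in at 0. sgn (f t - f 0) = sgn (fps_nth F m) * sgn t ^ m"
      using zero by (intro eventually_sgn_diff_of_expansion[OF f m _ lead])
    then show ?thesis
      by eventually_elim (use \<open>odd m\<close> in \<open>auto simp: sgn_if\<close>)
  qed
  have ev: "\<forall>\<^sub>F t in nhds 0. t \<in> eball 0 (fps_conv_radius F)"
    using rad by (intro eventually_nhds_in_open) (auto simp: zero_ereal_def)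
  have eq: "\<forall>\<^sub>F t in nhds 0. eval_fps F t = f t"
    using f by (simp add: has_fps_expansion_def)
  have "\<forall>\<^sub>F t in nhds 0. t \<in> eball 0 (fps_conv_radius F) \<and> eval_fps F t = f t \<and>
      (t \<noteq> 0 \<longrightarrow> eval_fps (fps_deriv F) t \<noteq> 0 \<and> sgn (f t - f 0) = sgn (fps_nth F m) * sgn t)"
    using ev eq deriv[unfolded eventually_at_filter] sgn[unfolded eventually_at_filter]
    by eventually_elim auto
  then obtain e where "e > 0" and e: "\<And>t. \<bar>t\<bar> < e \<Longrightarrow>
      t \<in> eball 0 (fps_conv_radius F) \<and> eval_fps F t = f t \<and>
      (t \<noteq> 0 \<longrightarrow> eval_fps (fps_deriv F) t \<noteq> 0 \<and> sgn (f t - f 0) = sgn (fps_nth F m) * sgn t)"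
    by (auto simp: eventually_nhds_metric dist_real_def)
  define U where "U = {-e<..<e}"
  have fU: "eval_fps F t = f t" if "t \<in> U" for t
    using e[of t] that by (auto simp: U_def abs_less_iff)
  have "continuous_on U (eval_fps F)"
    by (rule continuous_on_subset[OF continuous_on_eval_fps])
       (use e in \<open>auto simp: U_def abs_less_iff\<close>)
  then have cont: "continuous_on U f"
    by (simp add: fU cong: continuous_on_cong)
  \<comment> \<open>Rolle's theorem gives a zero of the derivative between two points with the same value;
    it can only be \<open>0\<close>, and then the two values lie on different sides of \<open>f 0\<close>.\<close>
  have neq: "f s \<noteq> f t" if st: "s \<in> U" "t \<in> U" "s < t" for s t
  proof
    assume "f s = f t"
    have sub: "{s..t} \<subseteq> U"
      using st by (auto simp: U_def)
    have der: "(eval_fps F has_real_derivative eval_fps (fps_deriv F) z) (at z)"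
      if "s \<le> z" "z \<le> t" for z
      using e[of z] sub that
      by (intro has_field_derivative_eval_fps) (auto simp: U_def abs_less_iff)
    obtain z where z: "s < z" "z < t"
        "eval_fps F t - eval_fps F s = (t - s) * eval_fps (fps_deriv F) z"
      using MVT2[OF \<open>s < t\<close> der] by blast
    have "eval_fps (fps_deriv F) z = 0"
      using z st fU \<open>f s = f t\<close> by auto
    then have "z = 0"
      using e[of z] sub z by (auto simp: U_def abs_less_iff subset_iff)
    with z have "s < 0" "0 < t" by auto
    with e[of s] e[of t] st
    have "sgn (f s - f 0) = - sgn (fps_nth F m)" "sgn (f t - f 0) = sgn (fps_nth F m)"
      by (auto simp: U_def abs_less_iff)
    with \<open>f s = f t\<close> lead show False
      by (auto simp: sgn_if split: if_splits)
  qed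
  have inj: "inj_on f U"
    by (rule inj_onI) (metis neq linorder_neqE_linordered_idom)
  have "open U" by (simp add: U_def)
  then obtain g where "homeomorphism U (f ` U) f g"
    using invariance_of_domain_homeomorphism[OF _ cont _ inj] by auto
  moreover have "open (f ` U)"
    using invariance_of_domain[OF cont \<open>open U\<close> inj] .
  moreover have "0 \<in> U" using \<open>e > 0\<close> by (simp add: U_def)
  ultimately show ?thesis
    unfolding topologically_regular_at_def
    by (intro exI[of _ U] exI[of _ "f ` U"] exI[of _ f] exI[of _ g] exI[of _ 0] exI[of _ 1])
       (simp add: \<open>open U\<close>)
qed

section \<open>Exclusion of the types\<close>

text \<open>Both inequalities are strict, and punctured neighbourhoods of \<open>a\<close> are
  nonempty, so they would contradict each other at some point.\<close>

lemma not_minimum_and_maximum: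
  assumes "local_minimum_at f a" "local_maximum_at f a"
  shows False
proof -
  have "\<forall>\<^sub>F t in at a. False"
    using assms unfolding local_minimum_at_def local_maximum_at_def
    by eventually_elim auto
  then show False by simp
qed

text \<open>By the intermediate value theorem, a value slightly above \<open>f a\<close> is attained
  on both sides of \<open>a\<close>.\<close>

lemma not_injective_at_local_minimum:
  assumes "local_minimum_at f a" "open U" "a \<in> U" "continuous_on U f"
  shows "\<not> inj_on f U"
proof
  assume inj: "inj_on f U"
  have "\<forall>\<^sub>F t in nhds a. t \<in> U \<and> (t \<noteq> a \<longrightarrow> f a < f t)"
    using eventually_nhds_in_open[OF \<open>open U\<close> \<open>a \<in> U\<close>]
      assms(1)[unfolded local_minimum_at_def eventually_at_filter]
    by eventually_elim auto
  then obtain e where "e > 0" and e: "\<And>t. \<bar>t - a\<bar> < e \<Longrightarrow> t \<in> U \<and> (t \<noteq> a \<longrightarrow> f a < f t)"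
    by (auto simp: eventually_nhds_metric dist_real_def)
  \<comment> \<open>The smaller of the two boundary values is reached on either side. It exceeds
    \<open>f a\<close>, so neither of the two preimages is \<open>a\<close> and they are
    distinct.\<close>
  define y where "y = min (f (a - e/2)) (f (a + e/2))"
  have y: "f a < y" "y \<le> f (a - e/2)" "y \<le> f (a + e/2)"
    using e[of "a - e/2"] e[of "a + e/2"] \<open>e > 0\<close> by (auto simp: y_def)
  have cont: "continuous_on {a - e/2..a + e/2} f"
    by (rule continuous_on_subset[OF assms(4)]) (use e \<open>e > 0\<close> in auto)
  have "\<exists>s\<ge>a - e/2. s \<le> a \<and> f s = y"
    using y \<open>e > 0\<close> by (intro IVT2' continuous_on_subset[OF cont]) auto
  moreover have "\<exists>t\<ge>a. t \<le> a + e/2 \<and> f t = y"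
    using y \<open>e > 0\<close> by (intro IVT' continuous_on_subset[OF cont]) auto
  ultimately obtain s t where st: "a - e/2 \<le> s" "s \<le> a" "f s = y" "a \<le> t" "t \<le> a + e/2" "f t = y"
    by auto
  then have "s \<in> U" "t \<in> U"
    using e[of s] e[of t] \<open>e > 0\<close> by auto
  with inj st have "s = t" by (auto dest: inj_onD)
  with st y show False by auto
qed

text \<open>An affine function of a homeomorphism with nonzero slope is continuous and injective,
  which a strict minimum excludes.\<close>

lemma not_regular_at_local_minimum:
  assumes "local_minimum_at f a"
  shows "\<not> topologically_regular_at f a"
proof
  assume "topologically_regular_at f a"
  then obtain U V h k \<alpha> \<beta> where *: "open U" "a \<in> U" "homeomorphism U V h k" "\<beta> \<noteq> 0"
      and eq: "\<forall>t\<in>U. f t = \<alpha> + \<beta> * h t"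
    unfolding topologically_regular_at_def by blast
  have "continuous_on U h" "inj_on h U"
    using *(3) by (auto simp: homeomorphism_def intro: inj_on_inverseI)
  then have "continuous_on U f" "inj_on f U"
    using eq \<open>\<beta> \<noteq> 0\<close>
    by (auto simp: inj_on_def continuous_on_cong[OF refl, of U f "\<lambda>t. \<alpha> + \<beta> * h t"]
        intro!: continuous_intros)
  with not_injective_at_local_minimum[OF assms *(1,2)] show False by blast
qed

lemma topologically_regular_uminus:
  assumes "topologically_regular_at f a"
  shows "topologically_regular_at (\<lambda>t. - f t) a"
proof -
  obtain U V h k \<alpha> \<beta> where *: "open U" "a \<in> U" "open V" "homeomorphism U V h k" "\<beta> \<noteq> 0"
      "\<forall>t\<in>U. f t = \<alpha> + \<beta> * h t"
    using assms unfolding topologically_regular_at_def by blast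
  then show ?thesis
    unfolding topologically_regular_at_def
    by (intro exI[of _ U] exI[of _ V] exI[of _ h] exI[of _ k] exI[of _ "- \<alpha>"] exI[of _ "- \<beta>"])
       auto
qed

lemma not_regular_at_local_maximum:
  assumes "local_maximum_at f a"
  shows "\<not> topologically_regular_at f a"
  using assms not_regular_at_local_minimum topologically_regular_uminus
  unfolding local_maximum_iff_minimum_uminus by blast

text \<open>The three types exclude each other, so sharing one of them settles all three
  equivalences.\<close>

lemma same_local_typeI:
  assumes "local_minimum_at f a \<and> local_minimum_at g a \<or>
           local_maximum_at f a \<and> local_maximum_at g a \<or>
           topologically_regular_at f a \<and> topologically_regular_at g a"
  shows "same_local_type f g a"
  using assms not_minimum_and_maximum not_regular_at_local_minimum not_regular_at_local_maximum
  unfolding same_local_type_def by blast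

section \<open>The distance function along the normal line\<close>

lemma orthogonal_to_first_iff:
  fixes e1 e2 d :: "real^2"
  assumes "norm e1 = 1" "norm e2 = 1" "orthogonal e1 e2"
  shows "orthogonal d e1 \<longleftrightarrow> (\<exists>w. d = w *\<^sub>R e2)"
proof
  assume "orthogonal d e1"
  have 1: "(e1 $ 1)\<^sup>2 + (e1 $ 2)\<^sup>2 = 1" "(e2 $ 1)\<^sup>2 + (e2 $ 2)\<^sup>2 = 1"
    using assms by (simp_all add: norm_vec_def L2_set_def UNIV_2)
  have 2: "e1 $ 1 * e2 $ 1 + e1 $ 2 * e2 $ 2 = 0" "d $ 1 * e1 $ 1 + d $ 2 * e1 $ 2 = 0"
    using assms \<open>orthogonal d e1\<close> by (simp_all add: orthogonal_def inner_vec_def UNIV_2)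
  \<comment> \<open>The factor in parentheses is the inner product of \<open>d\<close> and
    \<open>e2\<close>, the coordinate of \<open>d\<close> along \<open>e2\<close>. Both identities
    follow algebraically from the orthonormality relations and the orthogonality of \<open>d\<close>
    and \<open>e1\<close>.\<close>
  have "d $ 1 = (d $ 1 * e2 $ 1 + d $ 2 * e2 $ 2) * e2 $ 1"
       "d $ 2 = (d $ 1 * e2 $ 1 + d $ 2 * e2 $ 2) * e2 $ 2"
    using 1 2 by algebra+
  then have "d = (d $ 1 * e2 $ 1 + d $ 2 * e2 $ 2) *\<^sub>R e2"
    by (simp add: vec_eq_iff forall_2)
  then show "\<exists>w. d = w *\<^sub>R e2" ..
next
  assume "\<exists>w. d = w *\<^sub>R e2"
  with assms(3) show "orthogonal d e1"
    by (auto simp: orthogonal_def inner_commute)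
qed

text \<open>Orthogonality to every multiple of \<open>e1\<close> reduces to the multiple with factor
  1, and in the plane the vectors orthogonal to \<open>e1\<close> are the multiples of
  \<open>e2\<close>.\<close>

lemma normal_line_eq:
  fixes e1 e2 :: "real^2"
  assumes "norm e1 = 1" "norm e2 = 1" "orthogonal e1 e2"
    and "\<gamma> 0 = x" "tangent_line \<gamma> = range (\<lambda>s. x + s *\<^sub>R e1)"
  shows "normal_line \<gamma> = range (\<lambda>w. x + w *\<^sub>R e2)"
proof -
  have "u \<in> normal_line \<gamma> \<longleftrightarrow> orthogonal (u - x) e1" for u
    unfolding normal_line_def assms(4,5)
    by (auto simp: orthogonal_def dest: spec[of _ 1])
  also have "orthogonal (u - x) e1 \<longleftrightarrow> u \<in> range (\<lambda>w. x + w *\<^sub>R e2)" for u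
    unfolding orthogonal_to_first_iff[OF assms(1-3)]
    by (auto simp: algebra_simps)
  finally show ?thesis by blast
qed

text \<open>As \<open>e\<close> is a unit vector, the parametrization of the normal line by
  \<open>w\<close> is an isometry, so neighbourhoods on the line become neighbourhoods in the
  reals.\<close>

lemma focal_point_iff:
  fixes e :: "real^2"
  assumes "normal_line \<gamma> = range (\<lambda>w. x + w *\<^sub>R e)" "norm e = 1"
  shows "focal_point \<gamma> (x + w *\<^sub>R e) \<longleftrightarrow>
    \<not> (\<forall>\<^sub>F v in at w. same_local_type (sq_dist \<gamma> (x + v *\<^sub>R e)) (sq_dist \<gamma> (x + w *\<^sub>R e)) 0)"
proof -
  have "dist (x + v *\<^sub>R e) (x + w *\<^sub>R e) = dist v w" for v
    using assms(2) by (simp add: dist_norm flip: scaleR_left_diff_distrib)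
  moreover have "e \<noteq> 0" using assms(2) by auto
  ultimately show ?thesis
    unfolding focal_point_def assms(1) eventually_at by auto
qed

text \<open>At a non-focal point the types on both sides would agree with the type at the point
  itself, which would then be a minimum and a maximum at once.\<close>

lemma focal_if_min_changes_into_max:
  fixes e :: "real^2"
  assumes normal: "normal_line \<gamma> = range (\<lambda>w. x + w *\<^sub>R e)" and e: "norm e = 1"
    and n: "n \<in> {e, - e}" and change: "min_changes_into_max \<gamma> (x + w *\<^sub>R e) n"
  shows "focal_point \<gamma> (x + w *\<^sub>R e)"
proof (rule ccontr)
  let ?d = "\<lambda>w. sq_dist \<gamma> (x + w *\<^sub>R e)"
  assume "\<not> ?thesis"
  then have ev: "\<forall>\<^sub>F v in at w. same_local_type (?d v) (?d w) 0"
    by (simp add: focal_point_iff[OF normal e])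
  obtain s where n_eq: "n = s *\<^sub>R e" and "s \<noteq> 0"
    using n by (metis insertE empty_iff scaleR_minus1_left scaleR_one zero_neq_one
        neg_equal_0_iff_equal)
  \<comment> \<open>Transfers constancy of the type near \<open>w\<close> to the two one-sided
    approaches, used with \<open>r = - s\<close> and \<open>r = s\<close>.\<close>
  have lim: "filterlim (\<lambda>h. w + r * h) (at w) (at_right 0)" if "r \<noteq> 0" for r :: real
  proof (rule filterlim_atI)
    have "((\<lambda>h. w + r * h) \<longlongrightarrow> w + r * 0) (at_right 0)"
      by (intro tendsto_intros)
    then show "((\<lambda>h. w + r * h) \<longlongrightarrow> w) (at_right 0)" by simp
    show "\<forall>\<^sub>F h in at_right 0. w + r * h \<noteq> w"
      using eventually_at_right_less[of "0::real"] by eventually_elim (use that in auto)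
  qed
  have "\<forall>\<^sub>F h in at_right 0. same_local_type (?d (w + - s * h)) (?d w) 0"
    using filterlim_iff[THEN iffD1, OF lim[of "- s"]] \<open>s \<noteq> 0\<close> ev by auto
  moreover have "\<forall>\<^sub>F h in at_right 0. same_local_type (?d (w + s * h)) (?d w) 0"
    using filterlim_iff[THEN iffD1, OF lim[of s]] \<open>s \<noteq> 0\<close> ev by auto
  ultimately have "\<forall>\<^sub>F h in at_right (0::real). False"
    using change[unfolded min_changes_into_max_def, THEN conjunct1]
      change[unfolded min_changes_into_max_def, THEN conjunct2]
  proof eventually_elim
    case (elim h)
    have "x + w *\<^sub>R e - h *\<^sub>R n = x + (w + - s * h) *\<^sub>R e"
         "x + w *\<^sub>R e + h *\<^sub>R n = x + (w + s * h) *\<^sub>R e"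
      by (simp_all add: n_eq algebra_simps)
    with elim show False
      using not_minimum_and_maximum[of "?d w" 0] unfolding same_local_type_def by metis
  qed
  then show False by simp
qed

text \<open>Pythagoras in the frame of tangent and normal: \<open>fps_X ^ p\<close> and
  \<open>Z\<close> are the two coordinates of the branch, and \<open>w\<close> is the normal
  coordinate of the point from which the distance is measured.\<close>

definition dist_series :: "nat \<Rightarrow> real fps \<Rightarrow> real \<Rightarrow> real fps" where
  "dist_series p Z w = fps_X ^ (2 * p) + (Z - fps_const w)\<^sup>2"

lemma sq_dist_has_fps_expansion:
  fixes e1 e2 x :: "real^2"
  assumes "norm e1 = 1" "norm e2 = 1" "orthogonal e1 e2"
    and rad: "fps_conv_radius Z > 0"
    and G: "\<forall>i. G $ i = fps_const (x $ i) + fps_const (e1 $ i) * fps_X ^ p + fps_const (e2 $ i) * Z"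
  shows "sq_dist (branch_map G) (x + w *\<^sub>R e2) has_fps_expansion dist_series p Z w"
proof -
  have Z: "eval_fps Z has_fps_expansion Z"
    using rad by (rule eval_fps_has_fps_expansion)
  have "(\<lambda>t. x $ i + e1 $ i * t ^ p + e2 $ i * eval_fps Z t) has_fps_expansion G $ i" for i
    unfolding G[rule_format] by (intro fps_expansion_intros Z)
  then have "\<forall>i. \<forall>\<^sub>F t in nhds 0. branch_map G t $ i = x $ i + e1 $ i * t ^ p + e2 $ i * eval_fps Z t"
    unfolding has_fps_expansion_def branch_map_def by simp
  then have "\<forall>\<^sub>F t in nhds 0. \<forall>i. branch_map G t $ i = x $ i + e1 $ i * t ^ p + e2 $ i * eval_fps Z t"
    by (intro eventually_all_finite) auto
  then have "\<forall>\<^sub>F t in nhds 0. sq_dist (branch_map G) (x + w *\<^sub>R e2) t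
      = t ^ (2 * p) + (eval_fps Z t - w)\<^sup>2"
  proof eventually_elim
    case (elim t)
    then have "branch_map G t - (x + w *\<^sub>R e2) = t ^ p *\<^sub>R e1 + (eval_fps Z t - w) *\<^sub>R e2"
      by (simp add: vec_eq_iff algebra_simps)
    moreover have "orthogonal (t ^ p *\<^sub>R e1) ((eval_fps Z t - w) *\<^sub>R e2)"
      using assms(3) by (simp add: orthogonal_def)
    ultimately show ?case
      using assms(1,2) by (simp add: sq_dist_def norm_add_Pythagorean power_mult mult.commute)
  qed
  moreover have "(\<lambda>t. t ^ (2 * p) + (eval_fps Z t - w)\<^sup>2) has_fps_expansion dist_series p Z w"
    unfolding dist_series_def power2_eq_square by (intro fps_expansion_intros Z)
  ultimately show ?thesis
    unfolding has_fps_expansion_def by (auto elim: eventually_elim2)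
qed

text \<open>The square of \<open>Z\<close> starts at degree \<open>2 * q\<close> at the earliest and
  \<open>w\<^sup>2\<close> only affects degree 0, so in between only the tangential square and the
  cross term remain. For \<open>p < q\<close> this range contains both competing exponents
  \<open>2 * p\<close> and \<open>q\<close>.\<close>

lemma dist_series_nth:
  assumes "\<And>k. k < q \<Longrightarrow> fps_nth Z k = 0" "0 < k" "k < 2 * q"
  shows "fps_nth (dist_series p Z w) k = (if k = 2 * p then 1 else 0) - 2 * w * fps_nth Z k"
proof -
  have "Z = fps_X ^ q * fps_shift q Z"
    using assms(1) by (auto simp: fps_eq_iff fps_X_power_mult_nth)
  then have "Z\<^sup>2 = fps_X ^ (2 * q) * (fps_shift q Z)\<^sup>2"
    by (metis mult.commute power_mult power_mult_distrib)
  then have sq: "fps_nth (Z\<^sup>2) k = 0"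
    using assms(3) by (simp add: fps_X_power_mult_nth)
  have "dist_series p Z w = fps_X ^ (2 * p) + Z\<^sup>2 - fps_const (2 * w) * Z + fps_const (w\<^sup>2)"
    by (simp add: dist_series_def power2_diff fps_const_power fps_const_mult[symmetric] 
        numeral_fps_const mult.assoc mult.commute mult.left_commute del: fps_const_mult)
  with sq assms(2) show ?thesis
    by simp
qed

section \<open>Local types in the three regimes of the competition between \<open>2 * p\<close> and
  \<open>q\<close>\<close>

context
  fixes \<gamma> :: "real \<Rightarrow> real^2" and x e :: "real^2" and p q :: nat and Z :: "real fps"
  assumes expansion: "\<And>w. sq_dist \<gamma> (x + w *\<^sub>R e) has_fps_expansion dist_series p Z w"
    and pq: "0 < p" "p < q"
    and Z0: "\<And>k. k < q \<Longrightarrow> fps_nth Z k = 0"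
    and Zq: "fps_nth Z q \<noteq> 0"
begin

text \<open>In either case the cross term contributes nothing up to degree \<open>2 * p\<close>,
  where the coefficient is 1.\<close>

lemma minimum_if_tangential_wins:
  assumes "2 * p < q \<or> w = 0"
  shows "local_minimum_at (sq_dist \<gamma> (x + w *\<^sub>R e)) 0"
  by (rule local_minimum_of_expansion[OF expansion, of "2 * p"])
     (use assms pq Z0 in \<open>auto simp: dist_series_nth[OF Z0]\<close>)

text \<open>For equal exponents the leading coefficient is \<open>1 - 2 * w * fps_nth Z q\<close>;
  it changes sign at \<open>w = 1 / (2 * fps_nth Z q)\<close>, the centre of the best-tangent
  circle.\<close>

lemma minimum_if_balanced:
  assumes "q = 2 * p" "2 * w * fps_nth Z q < 1"
  shows "local_minimum_at (sq_dist \<gamma> (x + w *\<^sub>R e)) 0"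
  by (rule local_minimum_of_expansion[OF expansion, of "2 * p"])
     (use assms pq Z0 in \<open>auto simp: dist_series_nth[OF Z0]\<close>)

lemma maximum_if_balanced:
  assumes "q = 2 * p" "2 * w * fps_nth Z q > 1"
  shows "local_maximum_at (sq_dist \<gamma> (x + w *\<^sub>R e)) 0"
  by (rule local_maximum_of_expansion[OF expansion, of "2 * p"])
     (use assms pq Z0 in \<open>auto simp: dist_series_nth[OF Z0]\<close>)

text \<open>The first nonconstant term is now the cross term, with coefficient
  \<open>- 2 * w * fps_nth Z q\<close> at degree \<open>q\<close>.\<close>

lemma minimum_if_normal_wins:
  assumes "q < 2 * p" "even q" "w * fps_nth Z q < 0"
  shows "local_minimum_at (sq_dist \<gamma> (x + w *\<^sub>R e)) 0"
  by (rule local_minimum_of_expansion[OF expansion, of q])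
     (use assms pq Z0 in \<open>auto simp: dist_series_nth[OF Z0]\<close>)

lemma maximum_if_normal_wins:
  assumes "q < 2 * p" "even q" "w * fps_nth Z q > 0"
  shows "local_maximum_at (sq_dist \<gamma> (x + w *\<^sub>R e)) 0"
  by (rule local_maximum_of_expansion[OF expansion, of q])
     (use assms pq Z0 in \<open>auto simp: dist_series_nth[OF Z0]\<close>)

lemma regular_if_normal_wins:
  assumes "q < 2 * p" "odd q" "w \<noteq> 0"
  shows "topologically_regular_at (sq_dist \<gamma> (x + w *\<^sub>R e)) 0"
  by (rule topologically_regular_of_expansion[OF expansion, of q])
     (use assms pq Z0 Zq in \<open>auto simp: dist_series_nth[OF Z0]\<close>)

text \<open>The factor \<open>sgn c\<close> orients the normal from the centre \<open>x\<close> of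
  the branch towards the focal point: minima lie before the focal point, maxima beyond it.\<close>

lemma min_changes_into_max_if_balanced:
  assumes "q = 2 * p"
  defines "c \<equiv> fps_nth Z q"
  shows "min_changes_into_max \<gamma> (x + (1 / (2 * c)) *\<^sub>R e) (sgn c *\<^sub>R e)"
proof -
  have "c \<noteq> 0" using Zq by (simp add: c_def)
  have shift: "x + (1 / (2 * c)) *\<^sub>R e - h *\<^sub>R sgn c *\<^sub>R e = x + (1 / (2 * c) - h * sgn c) *\<^sub>R e"
    "x + (1 / (2 * c)) *\<^sub>R e + h *\<^sub>R sgn c *\<^sub>R e = x + (1 / (2 * c) + h * sgn c) *\<^sub>R e" for h
    by (simp_all add: algebra_simps)
  \<comment> \<open>The criteria of the balanced case compare these quantities with 1, so the sign
    of \<open>h\<close> alone decides.\<close>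
  have crit: "2 * (1 / (2 * c) - h * sgn c) * c = 1 - 2 * h * \<bar>c\<bar>"
    "2 * (1 / (2 * c) + h * sgn c) * c = 1 + 2 * h * \<bar>c\<bar>" for h
    using \<open>c \<noteq> 0\<close> by (simp_all add: field_simps abs_sgn)
  have "local_minimum_at (sq_dist \<gamma> (x + (1 / (2 * c) - h * sgn c) *\<^sub>R e)) 0"
       "local_maximum_at (sq_dist \<gamma> (x + (1 / (2 * c) + h * sgn c) *\<^sub>R e)) 0" if "0 < h" for h
    using crit[of h] \<open>0 < h\<close> \<open>c \<noteq> 0\<close>
    by (auto intro!: minimum_if_balanced maximum_if_balanced assms(1) simp flip: c_def)
  then show ?thesis
    unfolding min_changes_into_max_def shift
    by (auto intro: eventually_mono[OF eventually_at_right_less])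
qed

section \<open>Focal points when the exponents differ\<close>

context
  assumes normal: "normal_line \<gamma> = range (\<lambda>w. x + w *\<^sub>R e)" and e: "norm e = 1"
begin

lemma not_focal_if_tangential_wins:
  assumes "2 * p < q"
  shows "\<not> focal_point \<gamma> (x + w *\<^sub>R e)"
  unfolding focal_point_iff[OF normal e]
  using assms by (auto intro!: always_eventually same_local_typeI minimum_if_tangential_wins)

text \<open>Away from \<open>w = 0\<close> the type depends only on the parity of \<open>q\<close>
  and the sign of \<open>w\<close>, hence is locally constant. At \<open>w = 0\<close> there is a
  minimum, which does not persist on the side where \<open>w * fps_nth Z q > 0\<close>.\<close>

lemma focal_if_normal_wins_iff:
  assumes q: "q < 2 * p"
  shows "focal_point \<gamma> (x + w *\<^sub>R e) \<longleftrightarrow> w = 0"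
proof -
  let ?d = "\<lambda>w. sq_dist \<gamma> (x + w *\<^sub>R e)"
  have "\<forall>\<^sub>F v in at w. same_local_type (?d v) (?d w) 0" if "w \<noteq> 0"
  proof -
    \<comment> \<open>Positivity of \<open>v * w\<close> expresses that \<open>v\<close> has the
      same sign as \<open>w\<close>, without a case distinction.\<close>
    have "((\<lambda>v. v * w) \<longlongrightarrow> w * w) (at w)"
      by (intro tendsto_intros)
    moreover have "0 < w * w"
      using that by (simp add: zero_less_mult_iff linorder_neq_iff disj_commute)
    ultimately have "\<forall>\<^sub>F v in at w. v * w > 0"
      by (rule order_tendstoD(1))
    then show ?thesis
    proof eventually_elim
      case (elim v)
      then have sgn: "v * fps_nth Z q < 0 \<and> w * fps_nth Z q < 0 \<or>
          v * fps_nth Z q > 0 \<and> w * fps_nth Z q > 0" "v \<noteq> 0"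
        using Zq by (auto simp: zero_less_mult_iff mult_less_0_iff)
      show ?case
      proof (cases "even q")
        case True
        with sgn q show ?thesis
          by (auto intro!: same_local_typeI minimum_if_normal_wins maximum_if_normal_wins)
      next
        case False
        with sgn q that show ?thesis
          by (auto intro!: same_local_typeI regular_if_normal_wins)
      qed
    qed
  qed
  moreover have "\<not> (\<forall>\<^sub>F v in at 0. same_local_type (?d v) (?d 0) 0)"
  proof
    assume *: "\<forall>\<^sub>F v in at 0. same_local_type (?d v) (?d 0) 0"
    have min: "local_minimum_at (?d 0) 0"
      by (rule minimum_if_tangential_wins) simp
    obtain r where "r > 0" and r: "\<And>v. v \<noteq> 0 \<Longrightarrow> \<bar>v\<bar> < r \<Longrightarrow> same_local_type (?d v) (?d 0) 0"
      using * by (auto simp: eventually_at dist_real_def)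
    \<comment> \<open>The sign matters for even \<open>q\<close>: on the opposite side the distance
      has a minimum as well, and no contradiction would arise.\<close>
    define v where "v = r / 2 * sgn (fps_nth Z q)"
    have v: "v \<noteq> 0" "\<bar>v\<bar> < r" "v * fps_nth Z q > 0"
      using \<open>r > 0\<close> Zq by (auto simp: v_def sgn_if abs_mult mult_pos_neg)
    have "local_minimum_at (?d v) 0"
      using r[OF v(1,2)] min by (auto simp: same_local_type_def)
    moreover have "local_maximum_at (?d v) 0 \<or> topologically_regular_at (?d v) 0"
      using maximum_if_normal_wins[OF q _ v(3)] regular_if_normal_wins[OF q _ v(1)] by blast
    ultimately show False
      using not_minimum_and_maximum not_regular_at_local_minimum by blast
  qed
  ultimately show ?thesis
    unfolding focal_point_iff[OF normal e] by auto
qed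

end

end

theorem proposition4:
  fixes \<Phi> :: "real poly poly"
    and x e1 e2 :: "real^2"
    and p q :: nat
    and c \<rho> :: real
    and \<sigma> :: "real fps"
    and G :: "(real fps)^2"
    and \<gamma> :: "real \<Rightarrow> real^2"
  assumes "reduced_real_curve \<Phi>"
    and "algebraic_singular_point \<Phi> x"
    and "local_branch \<Phi> x G"
    and "\<gamma> = branch_map G"
    and "norm e1 = 1" and "norm e2 = 1" and "orthogonal e1 e2"
    and "tangent_line \<gamma> = range (\<lambda>s. x + s *\<^sub>R e1)"
    and "2 \<le> p" and "p < q" and "c \<noteq> 0"
    and "fps_conv_radius \<sigma> > 0" and "\<forall>n\<le>q. fps_nth \<sigma> n = 0"
    and "\<forall>i. G $ i = fps_const (x $ i) + fps_const (e1 $ i) * fps_X ^ p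
                + fps_const (e2 $ i) * (fps_const c * fps_X ^ q + \<sigma>)"
    and "\<rho> = competition_factor p q"
  shows "normal_line \<gamma> = range (\<lambda>u2. x + u2 *\<^sub>R e2) \<and>
         (\<rho> > 1 \<longrightarrow>
           (\<forall>u\<in>normal_line \<gamma>. local_minimum_at (sq_dist \<gamma> u) 0) \<and>
           \<not> (\<exists>u\<in>normal_line \<gamma>. focal_point \<gamma> u)) \<and>
         (\<rho> = 1 \<longrightarrow>
           (\<exists>u\<in>normal_line \<gamma>. u \<noteq> x \<and> focal_point \<gamma> u \<and>
              (\<exists>n\<in>{e2, - e2}. min_changes_into_max \<gamma> u n))) \<and>
         (\<rho> < 1 \<longrightarrow>
           (\<forall>u2. u2 \<noteq> 0 \<longrightarrow>
              (odd q \<longrightarrow> topologically_regular_at (sq_dist \<gamma> (x + u2 *\<^sub>R e2)) 0) \<and>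
              (even q \<longrightarrow> local_maximum_at (sq_dist \<gamma> (x + u2 *\<^sub>R e2)) 0 \<or>
                         local_minimum_at (sq_dist \<gamma> (x + u2 *\<^sub>R e2)) 0)) \<and>
           {u \<in> normal_line \<gamma>. focal_point \<gamma> u} = {x}) \<and>
         local_minimum_at (sq_dist \<gamma> x) 0"
proof -
  define Z where "Z = fps_const c * fps_X ^ q + \<sigma>"
  have rad: "fps_conv_radius Z > 0"
    using less_le_trans[OF _ fps_conv_radius_add[of "fps_const c * fps_X ^ q" \<sigma>], of 0]
      \<open>c \<noteq> 0\<close> \<open>fps_conv_radius \<sigma> > 0\<close> by (simp add: Z_def fps_conv_radius_cmult_left)
  have Z: "fps_nth Z k = 0" if "k < q" for k
    using that assms(13) by (simp add: Z_def)
  have Zq: "fps_nth Z q = c"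
    using assms(13) by (simp add: Z_def)
  have exp: "sq_dist \<gamma> (x + w *\<^sub>R e2) has_fps_expansion dist_series p Z w" for w
    unfolding assms(4) using assms(5-7) rad assms(14)[folded Z_def]
    by (rule sq_dist_has_fps_expansion)
  have "\<gamma> 0 = x"
    using assms(3) by (simp add: assms(4) branch_map_def local_branch_def eval_fps_at_0 vec_eq_iff)
  with assms(5-8) have normal: "normal_line \<gamma> = range (\<lambda>w. x + w *\<^sub>R e2)"
    by (intro normal_line_eq)
  have p: "0 < p" and nz: "fps_nth Z q \<noteq> 0"
    using \<open>2 \<le> p\<close> \<open>c \<noteq> 0\<close> Zq by auto
  note facts = exp p \<open>p < q\<close> Z nz
  \<comment> \<open>The competition factor compares the order \<open>q\<close> of the cross term
    with the order \<open>2 * p\<close> of the tangential square.\<close>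
  have \<rho>: "\<rho> > 1 \<longleftrightarrow> 2 * p < q" "\<rho> = 1 \<longleftrightarrow> q = 2 * p" "\<rho> < 1 \<longleftrightarrow> q < 2 * p"
    using p by (auto simp: assms(15) competition_factor_def field_simps)
  have min_x: "local_minimum_at (sq_dist \<gamma> x) 0"
    using minimum_if_tangential_wins[OF facts, of 0] by simp
  have tangential: "(\<forall>u\<in>normal_line \<gamma>. local_minimum_at (sq_dist \<gamma> u) 0) \<and>
      \<not> (\<exists>u\<in>normal_line \<gamma>. focal_point \<gamma> u)" if "2 * p < q"
    unfolding normal
    using that minimum_if_tangential_wins[OF facts]
      not_focal_if_tangential_wins[OF facts normal \<open>norm e2 = 1\<close>] by auto
  have balanced: "\<exists>u\<in>normal_line \<gamma>. u \<noteq> x \<and> focal_point \<gamma> u \<and>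
      (\<exists>n\<in>{e2, - e2}. min_changes_into_max \<gamma> u n)" if "q = 2 * p"
  proof -
    \<comment> \<open>At this point the leading coefficient \<open>1 - 2 * w * c\<close>
      vanishes.\<close>
    let ?u = "x + (1 / (2 * c)) *\<^sub>R e2"
    have mem: "sgn c *\<^sub>R e2 \<in> {e2, - e2}"
      using \<open>c \<noteq> 0\<close> by (auto simp: sgn_if)
    have change: "min_changes_into_max \<gamma> ?u (sgn c *\<^sub>R e2)"
      using min_changes_into_max_if_balanced[OF facts that] Zq by simp
    have "focal_point \<gamma> ?u"
      by (rule focal_if_min_changes_into_max[OF normal \<open>norm e2 = 1\<close> mem change])
    moreover have "?u \<noteq> x"
      using \<open>norm e2 = 1\<close> \<open>c \<noteq> 0\<close> by auto
    ultimately show ?thesis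
      unfolding normal using mem change by blast
  qed
  have types: "(odd q \<longrightarrow> topologically_regular_at (sq_dist \<gamma> (x + w *\<^sub>R e2)) 0) \<and>
      (even q \<longrightarrow> local_maximum_at (sq_dist \<gamma> (x + w *\<^sub>R e2)) 0 \<or>
                  local_minimum_at (sq_dist \<gamma> (x + w *\<^sub>R e2)) 0)" if "q < 2 * p" "w \<noteq> 0" for w
  proof -
    have "w * fps_nth Z q < 0 \<or> w * fps_nth Z q > 0"
      using that nz by (metis linorder_neqE_linordered_idom mult_eq_0_iff)
    then show ?thesis
      using that regular_if_normal_wins[OF facts] minimum_if_normal_wins[OF facts]
        maximum_if_normal_wins[OF facts] by blast
  qed
  have focal: "{u \<in> normal_line \<gamma>. focal_point \<gamma> u} = {x}" if "q < 2 * p"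
  proof -
    have iff: "focal_point \<gamma> (x + w *\<^sub>R e2) \<longleftrightarrow> w = 0" for w
      by (rule focal_if_normal_wins_iff[OF facts normal \<open>norm e2 = 1\<close> that])
    have "{u \<in> normal_line \<gamma>. focal_point \<gamma> u} = (\<lambda>w. x + w *\<^sub>R e2) ` {0}"
      unfolding normal using iff by blast
    then show ?thesis by simp
  qed
  show ?thesis
    using normal tangential balanced types focal min_x unfolding \<rho> by blast
qed

end
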